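(* Let $f$ be an amenable scalable function. If $\hat f^u$ is a mixed stable numerical algorithm implementing $f$, then it is forward stable.
   Context: Metric. Every $\mathbb{R}^d$ carries the coordinatewise relative error metric: $\operatorname{dist}(x,y)=\big(\sum_{i:\,x_i\ne0}(\log(x_i/y_i))^2\big)^{1/2}$ if $x,y$ have the same sign pattern in $\{-1,0,1\}^d$, and $\operatorname{dist}(x,y)=\infty$ otherwise. Topological notions refer to the topology of this metric. Condition number. For $f:S\to T$, $S\subseteq\mathbb{R}^m$, $T\subseteq\mathbb{R}^n$, and $x\in S$: $\kappa(f,x)=\lim_{\epsilon\to0}\sup\{\operatorname{dist}(f(x),f(y))/\operatorname{dist}(x,y): y\in S,\,0<\operatorname{dist}(x,y)\le\epsilon\}\in[0,\infty]$, with $\kappa(f,x)=0$ if $x$ is isolated in $S$. Put $\tilde\kappa(f,x)=1+\kappa(f,x)$. Scalable functions. A scalable function is a map $f:\bigsqcup_k S_k\to\bigsqcup_k\mathbb{R}^{n_k}$ of disjoint unions, given by maps $S_k\to\mathbb{R}^{n_k}$ (each also written $f$) with $S_k\subseteq\mathbb{R}^{m_k}$, where $(m_k),(n_k)$ are sequences of positive integers, both infinite or both finite of the same length. Put $M_k=\max(m_k,n_k)$. All polynomials below are assumed to be greater than $4$ and non-decreasing on $[1,\infty)$. Amenability. $f$ is amenable if there is a polynomial $a$ (an amenability polynomial) such that for all $k$ and $x\in S_k$: (A.1) the ball $B_x=\{y\in\mathbb{R}^{m_k}:\operatorname{dist}(x,y)\le\frac{1}{a(M_k)\tilde\kappa(f,x)}\}$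 is contained in $S_k$; (A.2) $\tilde\kappa(f,y)\le a(M_k)\tilde\kappa(f,x)$ for all $y\in B_x$. Floating-point arithmetic. A unit roundoff is $u=2^{-t}$ with $t>2$ an integer (the precision); $u$ always ranges over unit roundoffs. $\mathbb{F}_u=\{0\}\cup\{\pm m2^{e-t}: m,e\in\mathbb{Z},\,2^{t-1}\le m\le2^t-1\}$ (exponents unbounded), and $\mathrm{fl}_u:\mathbb{R}\to\mathbb{F}_u$ rounds to a nearest element (any usual tie-breaking), so $\mathrm{fl}_u(x)=x(1+\delta)$ with $|\delta|\le u$ and $\mathrm{fl}_u(x)=x$ for $x\in\mathbb{F}_u$. For each $\circ\in\{+,-,\cdot,/\}$ there is a floating-point operation $\hat\circ:\mathbb{F}_u\times\mathbb{F}_u\to\mathbb{F}_u$ with $x\,\hat\circ\,y=(x\circ y)(1+\delta)$, $|\delta|\le u$ (division by $0$ excepted). Algorithms. A BSS machine (Blum–Shub–Smale) is a finite connected directed graph acting on a memory consisting of bi-infinite real sequences $(\dots,s_{-1},s_0,s_1,\dots)$ with finitely many nonzero entries. Its nodes are: one input node (writes the input into memory); output nodes (terminate and read off the output); computation nodes (one of $+,-,\times,/$ on two memory entries, copying an entry, or adding a built-in real constant); branch nodes (two outgoing edges, the first taken iff $s_0>0$); shift nodes (shift the memory one step left or right). If a division by $0$ would occur, the machine loops forever. The numerical algorithm $\hat f^u$ attached to a BSS machine $\hat f$ is obtained by replacing each real operation by its floating-point counterpart in $\mathbb{F}_u$, and each real constant, input and output by its image under $\mathrm{fl}_u$ (coordinatewise);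 the machine may also access $u$ and $t$ as constants. $\hat f^u(x)$ denotes its output on input $x$, if it halts. Mixed stability. $\hat f$ (equivalently $\hat f^u$) is mixed stable for $f$ if there are polynomials $a,b,c$ such that for all $k$, all $x\in S_k$ and all unit roundoffs $0<u\le\frac1{a(M_k)}$: an output $\hat f^u(x)$ is produced and there is $y\in S_k$ with $\operatorname{dist}(\hat f^u(x),f(y))\le b(M_k)u$ and $\operatorname{dist}(x,y)\le c(M_k)u$. Forward stability. $\hat f$ (equivalently $\hat f^u$) is forward stable for $f$ if there is a polynomial $a$ (a stability polynomial) such that for all $k$, $x\in S_k$ and unit roundoffs $u$: $0<u\le\frac{1}{\tilde\kappa(f,x)a(M_k)}$ implies that $\hat f^u$ produces an output on $x$ and $\operatorname{dist}(\hat f^u(x),f(x))\le a(M_k)\tilde\kappa(f,x)u$. (No requirement when $\tilde\kappa(f,x)=\infty$.) *)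

theory Defs
  imports "HOL-Analysis.Analysis" "HOL-Computational_Algebra.Polynomial"
begin

text \<open>
  Points of \<open>\<real>\<^sup>d\<close> are real lists of length \<open>d\<close>, so that a scalable function can combine maps
  between spaces of varying dimension. Distances and condition numbers live in \<open>[0,\<infinity>]\<close>, i.e. in
  \<^typ>\<open>ennreal\<close>, where \<open>1 / \<infinity> = 0\<close>, \<open>\<infinity> / c = \<infinity>\<close> for finite \<open>c\<close>, and \<open>c * \<infinity> = \<infinity>\<close> for \<open>c > 0\<close>.
\<close>

definition space_R :: "nat \<Rightarrow> real list set" where
  "space_R d = {x. length x = d}"

text \<open>Equality of the sign patterns includes equality of the dimensions.\<close>

definition rel_dist :: "real list \<Rightarrow> real list \<Rightarrow> ennreal" where
  "rel_dist x y =
     (if map sgn x = map sgn y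
      then ennreal (sqrt (\<Sum>i\<in>{i. i < length x \<and> x ! i \<noteq> 0}. (ln (x ! i / y ! i))\<^sup>2))
      else \<infinity>)"

definition isolated_pt :: "real list set \<Rightarrow> real list \<Rightarrow> bool" where
  "isolated_pt S x \<longleftrightarrow> (\<exists>\<epsilon>>0::real. {y\<in>S. rel_dist x y \<le> ennreal \<epsilon>} = {x})"

definition cond_num :: "(real list \<Rightarrow> real list) \<Rightarrow> real list set \<Rightarrow> real list \<Rightarrow> ennreal" where
  "cond_num f S x =
     (if isolated_pt S x then 0
      else Lim (at_right (0::real))
        (\<lambda>\<epsilon>. SUP y\<in>{y\<in>S. 0 < rel_dist x y \<and> rel_dist x y \<le> ennreal \<epsilon>}.
                rel_dist (f x) (f y) / rel_dist x y))"

definition cond_num1 :: "(real list \<Rightarrow> real list) \<Rightarrow> real list set \<Rightarrow> real list \<Rightarrow> ennreal" where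
  "cond_num1 f S x = 1 + cond_num f S x"


text \<open>
  \<open>sf_index\<close> is the index set of the sequences (starting at 0); \<open>sf_map F k\<close> only matters on
  \<open>sf_dom F k\<close>.
\<close>

record scalable_fun =
  sf_index :: "nat set"
  sf_in :: "nat \<Rightarrow> nat"
  sf_out :: "nat \<Rightarrow> nat"
  sf_dom :: "nat \<Rightarrow> real list set"
  sf_map :: "nat \<Rightarrow> real list \<Rightarrow> real list"

definition is_scalable :: "scalable_fun \<Rightarrow> bool" where
  "is_scalable F \<longleftrightarrow>
     (sf_index F = UNIV \<or> (\<exists>N. sf_index F = {..<N})) \<and>
     (\<forall>k\<in>sf_index F. 0 < sf_in F k \<and> 0 < sf_out F k \<and>
        sf_dom F k \<subseteq> space_R (sf_in F k) \<and>
        sf_map F k ` sf_dom F k \<subseteq> space_R (sf_out F k))"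

definition sf_size :: "scalable_fun \<Rightarrow> nat \<Rightarrow> nat" where
  "sf_size F k = max (sf_in F k) (sf_out F k)"

definition sf_cond1 :: "scalable_fun \<Rightarrow> nat \<Rightarrow> real list \<Rightarrow> ennreal" where
  "sf_cond1 F k x = cond_num1 (sf_map F k) (sf_dom F k) x"

definition admissible_poly :: "real poly \<Rightarrow> bool" where
  "admissible_poly a \<longleftrightarrow> (\<forall>x\<ge>1. poly a x > 4) \<and> mono_on {1..} (poly a)"

definition amen_ball :: "scalable_fun \<Rightarrow> real poly \<Rightarrow> nat \<Rightarrow> real list \<Rightarrow> real list set" where
  "amen_ball F a k x =
     {y \<in> space_R (sf_in F k).
        rel_dist x y \<le> 1 / (ennreal (poly a (real (sf_size F k))) * sf_cond1 F k x)}"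

definition amenable :: "scalable_fun \<Rightarrow> bool" where
  "amenable F \<longleftrightarrow>
     (\<exists>a. admissible_poly a \<and>
        (\<forall>k\<in>sf_index F. \<forall>x\<in>sf_dom F k.
           amen_ball F a k x \<subseteq> sf_dom F k \<and>
           (\<forall>y\<in>amen_ball F a k x.
              sf_cond1 F k y \<le> ennreal (poly a (real (sf_size F k))) * sf_cond1 F k x)))"


text \<open>A unit roundoff is given by its precision \<open>t > 2\<close>.\<close>

definition roundoff :: "nat \<Rightarrow> real" where
  "roundoff t = 2 powi (- int t)"

definition fp_numbers :: "nat \<Rightarrow> real set" where
  "fp_numbers t =
     {0} \<union> {\<sigma> * of_int m * 2 powi (e - int t) | \<sigma> (m::int) e.
              \<sigma> \<in> {1, -1} \<and> 2 ^ (t - 1) \<le> m \<and> m \<le> 2 ^ t - 1}"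

datatype arith_op = Plus | Minus | Times | Divide

fun exact_op :: "arith_op \<Rightarrow> real \<Rightarrow> real \<Rightarrow> real" where
  "exact_op Plus x y = x + y"
| "exact_op Minus x y = x - y"
| "exact_op Times x y = x * y"
| "exact_op Divide x y = x / y"

record arithmetic =
  rnd :: "real \<Rightarrow> real"
  apply_op :: "arith_op \<Rightarrow> real \<Rightarrow> real \<Rightarrow> real"

text \<open>
  \<open>rnd\<close> is rounding to a nearest element with arbitrary tie-breaking; that \<open>rnd x = x (1 + \<delta>)\<close>
  with \<open>\<bar>\<delta>\<bar> \<le> u\<close>, and that \<open>rnd\<close> fixes the floating-point numbers, follows.
\<close>

definition fp_arithmetic :: "nat \<Rightarrow> arithmetic \<Rightarrow> bool" where
  "fp_arithmetic t A \<longleftrightarrow>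
     (\<forall>x. rnd A x \<in> fp_numbers t \<and> (\<forall>z\<in>fp_numbers t. \<bar>x - rnd A x\<bar> \<le> \<bar>x - z\<bar>)) \<and>
     (\<forall>opr. \<forall>x\<in>fp_numbers t. \<forall>y\<in>fp_numbers t. \<not> (opr = Divide \<and> y = 0) \<longrightarrow>
        apply_op A opr x y \<in> fp_numbers t \<and>
        (\<exists>\<delta>. \<bar>\<delta>\<bar> \<le> roundoff t \<and> apply_op A opr x y = exact_op opr x y * (1 + \<delta>)))"


text \<open>
  BSS machines. A machine is the list of its nodes; a node is referred to by its position in the
  list and carries the positions of its successors. Built-in constants are real numbers or the
  symbols for the unit roundoff \<open>u\<close> and the precision \<open>t\<close>.
\<close>

datatype const = Real_Const real | Roundoff_Const | Precision_Const

datatype computation =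
    Arith arith_op int int int  \<comment> \<open>operation, two argument cells, target cell\<close>
  | Copy int int                \<comment> \<open>source cell, target cell\<close>
  | Add_Const int const int     \<comment> \<open>source cell, constant, target cell\<close>

datatype direction = Shift_Left | Shift_Right

datatype node =
    Input nat
  | Output
  | Compute computation nat
  | Branch nat nat              \<comment> \<open>successors for \<open>s\<^sub>0 > 0\<close> and for \<open>s\<^sub>0 \<le> 0\<close>\<close>
  | Shift direction nat

fun successors :: "node \<Rightarrow> nat set" where
  "successors (Input p) = {p}"
| "successors Output = {}"
| "successors (Compute c p) = {p}"
| "successors (Branch p q) = {p, q}"
| "successors (Shift d p) = {p}"

type_synonym machine = "node list"

definition edges :: "machine \<Rightarrow> (nat \<times> nat) set" where
  "edges P = {(p, q). p < length P \<and> q \<in> successors (P ! p)}"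

definition is_input :: "machine \<Rightarrow> nat \<Rightarrow> bool" where
  "is_input P p \<longleftrightarrow> p < length P \<and> (\<exists>q. P ! p = Input q)"

definition bss_machine :: "machine \<Rightarrow> bool" where
  "bss_machine P \<longleftrightarrow>
     (\<exists>!p. is_input P p) \<and>
     edges P \<subseteq> {..<length P} \<times> {..<length P} \<and>
     (\<forall>p<length P. \<forall>q<length P. (p, q) \<in> (edges P \<union> (edges P)\<inverse>)\<^sup>*)"

text \<open>
  Memories reachable in a run have finite support. As usual for BSS machines with inputs of
  varying dimension, a vector \<open>(x\<^sub>1, \<dots>, x\<^sub>d)\<close> is stored as \<open>s\<^sub>i = x\<^sub>i\<close> for \<open>1 \<le> i \<le> d\<close>, with its
  dimension \<open>d\<close> in unary as \<open>s\<^sub>0 = s\<^sub>-\<^sub>1 = \<dots> = 1\<close> (\<open>d\<close> ones) and zeros elsewhere; an output is read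
  off by the same convention, its dimension being the least \<open>l\<close> with \<open>s\<^sub>-\<^sub>l = 0\<close>.
\<close>

type_synonym memory = "int \<Rightarrow> real"

definition write_input :: "real list \<Rightarrow> memory" where
  "write_input x = (\<lambda>i. if 1 \<le> i \<and> i \<le> int (length x) then x ! nat (i - 1)
                        else if - int (length x) < i \<and> i \<le> 0 then 1 else 0)"

definition read_output :: "memory \<Rightarrow> real list" where
  "read_output s = map (\<lambda>i. s (int i + 1)) [0..<(LEAST l. s (- int l) = 0)]"

fun const_val :: "nat \<Rightarrow> const \<Rightarrow> real" where
  "const_val t (Real_Const r) = r"
| "const_val t Roundoff_Const = roundoff t"
| "const_val t Precision_Const = real t"

fun compute :: "nat \<Rightarrow> arithmetic \<Rightarrow> computation \<Rightarrow> memory \<Rightarrow> memory" where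
  "compute t A (Arith opr i j k) s = s(k := apply_op A opr (s i) (s j))"
| "compute t A (Copy i k) s = s(k := s i)"
| "compute t A (Add_Const i c k) s = s(k := apply_op A Plus (s i) (rnd A (const_val t c)))"

fun divides_by_zero :: "computation \<Rightarrow> memory \<Rightarrow> bool" where
  "divides_by_zero (Arith opr i j k) s \<longleftrightarrow> opr = Divide \<and> s j = 0"
| "divides_by_zero _ s \<longleftrightarrow> False"

fun shift :: "direction \<Rightarrow> memory \<Rightarrow> memory" where
  "shift Shift_Left s = (\<lambda>i. s (i + 1))"
| "shift Shift_Right s = (\<lambda>i. s (i - 1))"

text \<open>
  One step on the input vector \<open>x\<close>, with all real operations, constants and inputs interpreted in
  the arithmetic \<open>A\<close>. At a division by \<open>0\<close> the configuration is repeated forever. (Exact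
  operations together with \<open>rnd = id\<close> give the BSS machine, floating-point arithmetic gives the
  numerical algorithm attached to it.)
\<close>

definition step :: "nat \<Rightarrow> arithmetic \<Rightarrow> machine \<Rightarrow> real list \<Rightarrow> nat \<times> memory \<Rightarrow> nat \<times> memory" where
  "step t A P x = (\<lambda>(p, s).
     case P ! p of
       Input q \<Rightarrow> (q, write_input (map (rnd A) x))
     | Output \<Rightarrow> (p, s)
     | Compute c q \<Rightarrow> if divides_by_zero c s then (p, s) else (q, compute t A c s)
     | Branch q r \<Rightarrow> if s 0 > 0 then (q, s) else (r, s)
     | Shift d q \<Rightarrow> (q, shift d s))"

definition initial :: "machine \<Rightarrow> nat \<times> memory" where
  "initial P = ((THE p. is_input P p), (\<lambda>i. 0))"

text \<open>The algorithm attached to \<open>P\<close> at precision \<open>t\<close> halts on \<open>x\<close> with output \<open>z\<close>.\<close>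

definition produces :: "nat \<Rightarrow> arithmetic \<Rightarrow> machine \<Rightarrow> real list \<Rightarrow> real list \<Rightarrow> bool" where
  "produces t A P x z \<longleftrightarrow>
     (\<exists>N p s. (step t A P x ^^ N) (initial P) = (p, s) \<and> P ! p = Output \<and>
              z = map (rnd A) (read_output s))"


text \<open>In the following, \<open>A t\<close> is the floating-point arithmetic used at precision \<open>t\<close>.\<close>

definition mixed_stable :: "(nat \<Rightarrow> arithmetic) \<Rightarrow> machine \<Rightarrow> scalable_fun \<Rightarrow> bool" where
  "mixed_stable A P F \<longleftrightarrow>
     (\<exists>a b c. admissible_poly a \<and> admissible_poly b \<and> admissible_poly c \<and>
        (\<forall>k\<in>sf_index F. \<forall>x\<in>sf_dom F k. \<forall>t>2.
           roundoff t \<le> 1 / poly a (real (sf_size F k)) \<longrightarrow>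
           (\<exists>z. produces t (A t) P x z \<and>
             (\<exists>y\<in>sf_dom F k.
                rel_dist z (sf_map F k y) \<le> ennreal (poly b (real (sf_size F k)) * roundoff t) \<and>
                rel_dist x y \<le> ennreal (poly c (real (sf_size F k)) * roundoff t)))))"

definition forward_stable :: "(nat \<Rightarrow> arithmetic) \<Rightarrow> machine \<Rightarrow> scalable_fun \<Rightarrow> bool" where
  "forward_stable A P F \<longleftrightarrow>
     (\<exists>a. admissible_poly a \<and>
        (\<forall>k\<in>sf_index F. \<forall>x\<in>sf_dom F k. \<forall>t>2.
           ennreal (roundoff t) \<le> 1 / (sf_cond1 F k x * ennreal (poly a (real (sf_size F k)))) \<longrightarrow>
           (\<exists>z. produces t (A t) P x z \<and>
             rel_dist z (sf_map F k x)
               \<le> ennreal (poly a (real (sf_size F k))) * sf_cond1 F k x * ennreal (roundoff t))))"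

end

theory Submission
  imports Defs
begin

text \<open>
  Mixed stability gives a \<open>y\<close> with \<open>dist(f\<^sup>u(x), f(y)) \<le> b u\<close> and \<open>dist(x, y) \<le> c u\<close>. For small
  \<open>u\<close> the geodesic from \<open>x\<close> to \<open>y\<close> (a segment in logarithmic coordinates) stays in the amenability
  ball of \<open>x\<close>, where the condition number is less than \<open>L = \<alpha> (1 + \<kappa>(f, x))\<close>, \<open>\<alpha>\<close> being the
  amenability polynomial. The condition number is a pointwise Lipschitz constant, so a mean value
  inequality along the geodesic gives \<open>dist(f(x), f(y)) \<le> L dist(x, y)\<close>; now use the triangle
  inequality.
\<close>

section \<open>The relative error metric on real lists\<close>

lemma map_sgn_eq_iff:
  fixes x y :: "real list"
  shows "map sgn x = map sgn y \<longleftrightarrow>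
    length x = length y \<and> (\<forall>i<length x. sgn (x ! i) = sgn (y ! i))"
  by (auto simp: list_eq_iff_nth_eq)

lemma rel_dist_eq_L2_set:
  assumes "map sgn x = map sgn y"
  shows "rel_dist x y =
    ennreal (L2_set (\<lambda>i. ln (x ! i / y ! i)) {i. i < length x \<and> x ! i \<noteq> 0})"
  using assms by (simp add: rel_dist_def L2_set_def)

lemma rel_dist_finite_imp_same_signs: "rel_dist x y < \<infinity> \<Longrightarrow> map sgn x = map sgn y"
  by (auto simp: rel_dist_def split: if_splits)

text \<open>The sum in \<open>rel_dist\<close> runs over the support of its first argument only;
  symmetry and the triangle inequality require moving it to another point.\<close>

lemma same_signs_support:
  fixes x y :: "real list"
  assumes "map sgn x = map sgn y"
  shows "{i. i < length x \<and> x ! i \<noteq> 0} = {i. i < length y \<and> y ! i \<noteq> 0}"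
  using assms by (auto simp: map_sgn_eq_iff) (metis sgn_0_0)+

lemma same_signs_ratio_pos:
  fixes x y :: "real list"
  assumes "map sgn x = map sgn y" "i < length x" "x ! i \<noteq> 0"
  shows "0 < x ! i / y ! i"
proof -
  have "sgn (x ! i) = sgn (y ! i)" using assms by (auto simp: map_sgn_eq_iff)
  then show ?thesis using assms(3) by (auto simp: sgn_if zero_less_divide_iff split: if_splits)
qed

lemma rel_dist_self [simp]: "rel_dist x x = 0"
  by (auto simp: rel_dist_def intro!: sum.neutral)

lemma rel_dist_commute: "rel_dist x y = rel_dist y x"
proof (cases "map sgn x = map sgn y")
  case True
  have "ln (x ! i / y ! i) = - ln (y ! i / x ! i)" if "i < length x" "x ! i \<noteq> 0" for i
    using same_signs_ratio_pos[OF True that] ln_inverse[of "y ! i / x ! i"] by simp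
  then have "(\<Sum>i\<in>{i. i < length x \<and> x ! i \<noteq> 0}. (ln (x ! i / y ! i))\<^sup>2) =
      (\<Sum>i\<in>{i. i < length x \<and> x ! i \<noteq> 0}. (ln (y ! i / x ! i))\<^sup>2)"
    by (intro sum.cong) auto
  then show ?thesis
    using True unfolding rel_dist_def by (simp add: same_signs_support[OF True])
qed (auto simp: rel_dist_def)

text \<open>Logarithms of ratios telescope, so this is Minkowski's inequality for
  \<open>L2_set\<close>. If signs change on either leg, the right-hand side is infinite.\<close>

lemma rel_dist_triangle: "rel_dist x z \<le> rel_dist x y + rel_dist y z"
proof (cases "map sgn x = map sgn y \<and> map sgn y = map sgn z")
  case True
  then have xy: "map sgn x = map sgn y" and yz: "map sgn y = map sgn z" by auto
  let ?I = "{i. i < length x \<and> x ! i \<noteq> 0}"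
  have I: "{i. i < length y \<and> y ! i \<noteq> 0} = ?I" using same_signs_support[OF xy] by simp
  have "ln (x ! i / z ! i) = ln (x ! i / y ! i) + ln (y ! i / z ! i)" if "i \<in> ?I" for i
  proof -
    have "i < length y" "y ! i \<noteq> 0" using that I by blast+
    then show ?thesis
      using same_signs_ratio_pos[OF xy, of i] same_signs_ratio_pos[OF yz, of i] that
        ln_mult_pos[of "x ! i / y ! i" "y ! i / z ! i"] by simp
  qed
  then have "L2_set (\<lambda>i. ln (x ! i / z ! i)) ?I =
      L2_set (\<lambda>i. ln (x ! i / y ! i) + ln (y ! i / z ! i)) ?I"
    by (intro L2_set_cong) auto
  also have "\<dots> \<le> L2_set (\<lambda>i. ln (x ! i / y ! i)) ?I + L2_set (\<lambda>i. ln (y ! i / z ! i)) ?I"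
    by (rule L2_set_triangle_ineq)
  finally show ?thesis
    using xy yz by (simp add: rel_dist_eq_L2_set I ennreal_leI flip: ennreal_plus)
next
  case False
  then show ?thesis by (auto simp: rel_dist_def)
qed

section \<open>Geodesics in logarithmic coordinates\<close>

text \<open>Where \<open>x\<^sub>i = 0\<close>, the junk value \<open>ln (y\<^sub>i / 0)\<close> is harmless: the factor \<open>x\<^sub>i\<close> vanishes.\<close>

definition rel_geodesic :: "real list \<Rightarrow> real list \<Rightarrow> real \<Rightarrow> real list" where
  "rel_geodesic x y s = map (\<lambda>i. x ! i * exp (s * ln (y ! i / x ! i))) [0..<length x]"

lemma length_rel_geodesic [simp]: "length (rel_geodesic x y s) = length x"
  by (simp add: rel_geodesic_def)

lemma nth_rel_geodesic:
  "i < length x \<Longrightarrow> rel_geodesic x y s ! i = x ! i * exp (s * ln (y ! i / x ! i))"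
  by (simp add: rel_geodesic_def)

lemma rel_geodesic_0 [simp]: "rel_geodesic x y 0 = x"
  by (auto simp: list_eq_iff_nth_eq nth_rel_geodesic)

lemma rel_geodesic_1:
  assumes "map sgn x = map sgn y"
  shows "rel_geodesic x y 1 = y"
proof (intro nth_equalityI)
  show "length (rel_geodesic x y 1) = length y" using assms by (simp add: map_sgn_eq_iff)
next
  fix i assume "i < length (rel_geodesic x y 1)"
  then have i: "i < length x" by simp
  show "rel_geodesic x y 1 ! i = y ! i"
  proof (cases "x ! i = 0")
    case True
    then have "y ! i = 0" using assms i by (metis map_sgn_eq_iff sgn_0_0)
    then show ?thesis using True i by (simp add: nth_rel_geodesic)
  next
    case False
    have "0 < y ! i / x ! i"
      using same_signs_ratio_pos[OF assms i False] by (auto simp: zero_less_divide_iff)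
    then show ?thesis using False i by (simp add: nth_rel_geodesic)
  qed
qed

text \<open>On the support the factor \<open>x ! i\<close> cancels from the ratio of two geodesic
  points, so every logarithm scales by \<open>s - r\<close> up to a sign that squaring
  removes.\<close>

lemma rel_dist_geodesic:
  assumes "map sgn x = map sgn y"
  shows "rel_dist (rel_geodesic x y s) (rel_geodesic x y r) = ennreal \<bar>s - r\<bar> * rel_dist x y"
proof -
  let ?w = "rel_geodesic x y" and ?I = "{i. i < length x \<and> x ! i \<noteq> 0}"
  have sg: "map sgn (?w s) = map sgn (?w r)"
    by (auto simp: map_sgn_eq_iff nth_rel_geodesic sgn_mult)
  have I: "{i. i < length (?w s) \<and> ?w s ! i \<noteq> 0} = ?I"
    by (auto simp: nth_rel_geodesic)
  have "(ln (?w s ! i / ?w r ! i))\<^sup>2 = ((s - r) * ln (x ! i / y ! i))\<^sup>2" if "i \<in> ?I" for i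
  proof -
    have i: "i < length x" "x ! i \<noteq> 0" using that by auto
    have "ln (y ! i / x ! i) = - ln (x ! i / y ! i)"
      using same_signs_ratio_pos[OF assms i] ln_inverse[of "x ! i / y ! i"] by simp
    moreover have "?w s ! i / ?w r ! i = exp ((s - r) * ln (y ! i / x ! i))"
      using i by (simp add: nth_rel_geodesic left_diff_distrib exp_diff)
    ultimately show ?thesis by (simp add: power2_eq_square)
  qed
  then have "L2_set (\<lambda>i. ln (?w s ! i / ?w r ! i)) ?I =
      sqrt (\<Sum>i\<in>?I. (s - r)\<^sup>2 * (ln (x ! i / y ! i))\<^sup>2)"
    unfolding L2_set_def by (simp add: power_mult_distrib)
  also have "\<dots> = \<bar>s - r\<bar> * L2_set (\<lambda>i. ln (x ! i / y ! i)) ?I"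
    by (simp add: L2_set_def real_sqrt_mult flip: sum_distrib_left)
  finally show ?thesis
    unfolding rel_dist_eq_L2_set[OF assms] rel_dist_eq_L2_set[OF sg] I
    by (simp add: ennreal_mult)
qed

section \<open>The condition number as a local Lipschitz constant\<close>

text \<open>The supremum is monotone in \<epsilon>, so its limit at 0 is an infimum; if that lies
  below \<open>L\<close>, so does the supremum for some radius.\<close>

lemma cond_num_less_imp_locally_lipschitz:
  assumes "x \<in> S" "cond_num f S x < L"
  shows "\<exists>\<epsilon>>0. \<forall>y\<in>S. 0 < rel_dist x y \<longrightarrow> rel_dist x y \<le> ennreal \<epsilon> \<longrightarrow>
    rel_dist (f x) (f y) \<le> L * rel_dist x y"
proof (cases "isolated_pt S x")
  case True
  then obtain \<epsilon> where "\<epsilon> > 0" and \<epsilon>: "{y\<in>S. rel_dist x y \<le> ennreal \<epsilon>} = {x}"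
    unfolding isolated_pt_def by blast
  have "y = x" if "y \<in> S" "rel_dist x y \<le> ennreal \<epsilon>" for y
    using that \<epsilon> by blast
  then show ?thesis using \<open>\<epsilon> > 0\<close> by (metis order_less_irrefl rel_dist_self)
next
  case False
  define g where "g = (\<lambda>\<epsilon>. SUP y\<in>{y\<in>S. 0 < rel_dist x y \<and> rel_dist x y \<le> ennreal \<epsilon>}.
    rel_dist (f x) (f y) / rel_dist x y)"
  have mono: "g \<epsilon> \<le> g \<epsilon>'" if "\<epsilon> \<le> \<epsilon>'" for \<epsilon> \<epsilon>'
    unfolding g_def using that by (intro SUP_subset_mono) (auto intro: order_trans ennreal_leI)
  \<comment> \<open>\<open>Lim\<close> is a definite description, so convergence has to be
    established before its value can be used.\<close>
  have lim: "(g \<longlongrightarrow> (INF \<epsilon>\<in>{0<..}. g \<epsilon>)) (at_right 0)"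
  proof (rule order_tendstoI)
    fix a assume "a < (INF \<epsilon>\<in>{0<..}. g \<epsilon>)"
    then have "\<And>\<epsilon>. \<epsilon> > 0 \<Longrightarrow> a < g \<epsilon>"
      by (metis INF_lower greaterThan_iff order_less_le_trans)
    then show "eventually (\<lambda>\<epsilon>. a < g \<epsilon>) (at_right 0)"
      by (auto simp: eventually_at_right_field intro: exI[of _ 1])
  next
    fix a assume "(INF \<epsilon>\<in>{0<..}. g \<epsilon>) < a"
    then obtain \<epsilon>' where "\<epsilon>' > 0" "g \<epsilon>' < a" by (auto simp: INF_less_iff)
    then show "eventually (\<lambda>\<epsilon>. g \<epsilon> < a) (at_right 0)"
      unfolding eventually_at_right_field
      by (intro exI[of _ \<epsilon>'] conjI allI impI) (auto intro!: order_le_less_trans[OF mono[of _ \<epsilon>']])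
  qed
  have "cond_num f S x = Lim (at_right 0) g"
    using False by (simp add: cond_num_def g_def)
  also have "\<dots> = (INF \<epsilon>\<in>{0<..}. g \<epsilon>)"
    using lim by (intro tendsto_Lim) auto
  finally obtain \<epsilon> where \<epsilon>: "\<epsilon> > 0" "g \<epsilon> < L" using assms(2) by (auto simp: INF_less_iff)
  have "rel_dist (f x) (f y) \<le> L * rel_dist x y"
    if y: "y \<in> S" "0 < rel_dist x y" "rel_dist x y \<le> ennreal \<epsilon>" for y
  proof -
    have "rel_dist (f x) (f y) / rel_dist x y \<le> g \<epsilon>"
      unfolding g_def using y by (intro SUP_upper) auto
    then have le: "rel_dist (f x) (f y) / rel_dist x y \<le> L" using \<epsilon>(2) by simp
    \<comment> \<open>Division in \<open>ennreal\<close> cancels only for a divisor that is neither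
      0 nor infinite.\<close>
    have "rel_dist x y < top" using y(3) ennreal_less_top by (rule order_le_less_trans)
    then have "rel_dist (f x) (f y) = rel_dist (f x) (f y) / rel_dist x y * rel_dist x y"
      using y(2) by (simp add: ennreal_divide_times ennreal_divide_self)
    also have "\<dots> \<le> L * rel_dist x y" using le by (rule mult_right_mono) simp
    finally show ?thesis .
  qed
  with \<epsilon>(1) show ?thesis by blast
qed

section \<open>Mean value inequality along geodesics\<close>

text \<open>
  The relation \<open>dist(f(w\<^sub>s), f(w\<^sub>r)) \<le> L (r - s) dist(x, y)\<close> for \<open>s \<le> r\<close> is transitive along the
  geodesic \<open>w\<close> and holds locally around each point, so Bolzano's compactness argument applies.
\<close>

lemma rel_dist_mean_value:
  assumes fin: "rel_dist x y < \<infinity>" and L: "0 \<le> L"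
    and S: "\<And>s. s \<in> {0..1} \<Longrightarrow> rel_geodesic x y s \<in> S"
    and cond: "\<And>s. s \<in> {0..1} \<Longrightarrow> cond_num f S (rel_geodesic x y s) < ennreal L"
  shows "rel_dist (f x) (f y) \<le> ennreal L * rel_dist x y"
proof (cases "rel_dist x y = 0")
  case True
  have sg: "map sgn x = map sgn y" using fin by (rule rel_dist_finite_imp_same_signs)
  \<comment> \<open>Zero distance is treated apart because the radius \<open>\<epsilon> / D\<close>
    below presupposes \<open>D > 0\<close>.\<close>
  have "x = y"
  proof (rule nth_equalityI)
    show "length x = length y" using sg by (simp add: map_sgn_eq_iff)
  next
    fix i assume i: "i < length x"
    show "x ! i = y ! i"
    proof (cases "x ! i = 0")
      case zero: True
      then show ?thesis using sg i by (metis map_sgn_eq_iff sgn_0_0)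
    next
      case False
      have "ln (x ! i / y ! i) = 0"
        using True i False
        by (simp add: rel_dist_eq_L2_set[OF sg] ennreal_eq_0_iff order_antisym_conv L2_set_eq_0_iff)
      then show ?thesis using same_signs_ratio_pos[OF sg i False] by simp
    qed
  qed
  then show ?thesis by simp
next
  case False
  let ?w = "rel_geodesic x y"
  have sg: "map sgn x = map sgn y" using fin by (rule rel_dist_finite_imp_same_signs)
  obtain D where D: "rel_dist x y = ennreal D" "D \<ge> 0"
    using fin by (cases "rel_dist x y") auto
  with False have "D > 0" by (cases "D = 0") auto
  have dist: "rel_dist (?w s) (?w r) = ennreal (\<bar>s - r\<bar> * D)" for s r
    using D by (simp add: rel_dist_geodesic[OF sg] ennreal_mult)
  \<comment> \<open>Bolzano's local condition ranges over intervals that may leave [0,1], hence the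
    bounds as premises inside \<open>Q\<close>.\<close>
  define Q where "Q s r \<longleftrightarrow> 0 \<le> s \<longrightarrow> s \<le> r \<longrightarrow> r \<le> 1 \<longrightarrow>
    rel_dist (f (?w s)) (f (?w r)) \<le> ennreal (L * ((r - s) * D))" for s r
  \<comment> \<open>Stated for arbitrary points, as it serves both to chain intervals and to join
    the two sides of a base point.\<close>
  have combine: "rel_dist u v \<le> ennreal (L * ((r - s) * D))"
    if "rel_dist u m \<le> ennreal (L * ((q - s) * D))" "rel_dist m v \<le> ennreal (L * ((r - q) * D))"
      "s \<le> q" "q \<le> r" for u m v s q r
  proof -
    have "rel_dist u v \<le> rel_dist u m + rel_dist m v" by (rule rel_dist_triangle)
    also have "\<dots> \<le> ennreal (L * ((q - s) * D)) + ennreal (L * ((r - q) * D))"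
      using that by (intro add_mono)
    also have "\<dots> = ennreal (L * ((r - s) * D))"
      using that L D
      by (simp add: distrib_left[symmetric] distrib_right[symmetric] flip: ennreal_plus)
    finally show ?thesis .
  qed
  have loc: "\<exists>d>0. \<forall>r. r \<in> {0..1} \<and> \<bar>q - r\<bar> < d \<longrightarrow>
      rel_dist (f (?w q)) (f (?w r)) \<le> ennreal (L * (\<bar>q - r\<bar> * D))" if q: "q \<in> {0..1}" for q
  proof -
    obtain \<epsilon> where \<epsilon>: "\<epsilon> > 0" "\<And>v. v \<in> S \<Longrightarrow> 0 < rel_dist (?w q) v \<Longrightarrow>
        rel_dist (?w q) v \<le> ennreal \<epsilon> \<Longrightarrow>
        rel_dist (f (?w q)) (f v) \<le> ennreal L * rel_dist (?w q) v"
      using cond_num_less_imp_locally_lipschitz[OF S[OF q] cond[OF q]] by blast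
    have "rel_dist (f (?w q)) (f (?w r)) \<le> ennreal (L * (\<bar>q - r\<bar> * D))"
      \<comment> \<open>Parameters at distance less than \<open>\<epsilon> / D\<close> give points
        at distance less than \<epsilon>, since the geodesic has constant speed
        \<open>D\<close>.\<close>
      if r: "r \<in> {0..1}" "\<bar>q - r\<bar> < \<epsilon> / D" for r
    proof (cases "q = r")
      case False
      have "\<bar>q - r\<bar> * D \<le> \<epsilon>" using r \<open>D > 0\<close> by (simp add: field_simps)
      then have "rel_dist (f (?w q)) (f (?w r)) \<le> ennreal L * ennreal (\<bar>q - r\<bar> * D)"
        using \<epsilon>(2)[OF S[OF r(1)]] False \<open>D > 0\<close> by (simp only: dist) (simp add: ennreal_leI)
      then show ?thesis using L D by (simp add: ennreal_mult)
    qed simp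
    moreover have "\<epsilon> / D > 0" using \<epsilon>(1) \<open>D > 0\<close> by simp
    ultimately show ?thesis by blast
  qed
  have "Q 0 1"
  proof (rule Bolzano)
    fix s q r assume "Q s q" "Q q r" "s \<le> q" "q \<le> r"
    then show "Q s r"
      unfolding Q_def by (auto intro: combine[of _ "f (?w q)" q s _ r])
  next
    fix q :: real assume "0 \<le> q" "q \<le> 1"
    then obtain d where d: "d > 0" "\<And>r. r \<in> {0..1} \<Longrightarrow> \<bar>q - r\<bar> < d \<Longrightarrow>
        rel_dist (f (?w q)) (f (?w r)) \<le> ennreal (L * (\<bar>q - r\<bar> * D))"
      using loc[of q] by auto
    \<comment> \<open>The local bound only controls pairs containing the base point
      \<open>q\<close>, so the interval is split at \<open>q\<close>.\<close>
    have "Q s r" if "s \<le> q" "q \<le> r" "r - s < d" for s r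
      unfolding Q_def
    proof (intro impI)
      assume "0 \<le> s" "s \<le> r" "r \<le> 1"
      with that d(2)[of s] d(2)[of r]
      show "rel_dist (f (?w s)) (f (?w r)) \<le> ennreal (L * ((r - s) * D))"
        by (intro combine[of "f (?w s)" "f (?w q)" q s "f (?w r)" r])
          (auto simp: rel_dist_commute[of "f (?w s)"])
    qed
    with d(1) show "\<exists>d>0. \<forall>a b. a \<le> q \<and> q \<le> b \<and> b - a < d \<longrightarrow> Q a b" by blast
  qed simp
  then show ?thesis
    unfolding Q_def using L D by (simp add: rel_geodesic_1[OF sg] ennreal_mult)
qed

section \<open>Lipschitz bounds on amenability balls\<close>

text \<open>Geodesic points are no farther from \<open>x\<close> than \<open>y\<close> is, so the
  whole geodesic lies in the ball, where (A.2) bounds the condition number uniformly.\<close>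

lemma amenable_lipschitz:
  assumes amen: "amen_ball F \<alpha> k x \<subseteq> sf_dom F k"
      "\<forall>y\<in>amen_ball F \<alpha> k x. sf_cond1 F k y \<le> ennreal (poly \<alpha> (real (sf_size F k))) * sf_cond1 F k x"
    and x: "x \<in> space_R (sf_in F k)"
    and K: "sf_cond1 F k x = ennreal K" "0 \<le> K"
    and \<alpha>: "0 < poly \<alpha> (real (sf_size F k))"
    and y: "y \<in> amen_ball F \<alpha> k x"
    and fin: "rel_dist x y < \<infinity>"
  shows "rel_dist (sf_map F k x) (sf_map F k y)
    \<le> ennreal (poly \<alpha> (real (sf_size F k)) * K) * rel_dist x y"
proof (rule rel_dist_mean_value[OF fin, where S = "sf_dom F k"])
  let ?p = "poly \<alpha> (real (sf_size F k))"
  show "0 \<le> ?p * K" using \<alpha> K by simp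
  have sg: "map sgn x = map sgn y" using fin by (rule rel_dist_finite_imp_same_signs)
  fix s :: real assume s: "s \<in> {0..1}"
  have "rel_dist x (rel_geodesic x y s) = ennreal s * rel_dist x y"
    using rel_dist_geodesic[OF sg, of 0 s] s by simp
  also have "\<dots> \<le> 1 * rel_dist x y" using s by (intro mult_right_mono) auto
  finally have ball: "rel_geodesic x y s \<in> amen_ball F \<alpha> k x"
    using x y by (auto simp: amen_ball_def space_R_def)
  then show "rel_geodesic x y s \<in> sf_dom F k" using amen(1) by blast
  \<comment> \<open>The summand 1 supplies the strict inequality that the mean value lemma
    requires.\<close>
  have le: "1 + cond_num (sf_map F k) (sf_dom F k) (rel_geodesic x y s) \<le> ennreal (?p * K)"
    using bspec[OF amen(2) ball] K \<alpha>
    by (simp add: sf_cond1_def cond_num1_def ennreal_mult)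
  show "cond_num (sf_map F k) (sf_dom F k) (rel_geodesic x y s) < ennreal (?p * K)"
  proof (cases "cond_num (sf_map F k) (sf_dom F k) (rel_geodesic x y s)")
    case (real c)
    then have "ennreal (1 + c) \<le> ennreal (?p * K)" using le by (simp add: ennreal_plus)
    then have "1 + c \<le> ?p * K" using \<alpha> K by (subst (asm) ennreal_le_iff) auto
    then show ?thesis using real by (simp add: ennreal_less_iff)
  next
    case top
    with le show ?thesis by (simp add: top_unique)
  qed
qed

section \<open>Closure properties of admissible polynomials\<close>

lemma admissible_poly_add:
  assumes "admissible_poly p" "admissible_poly q"
  shows "admissible_poly (p + q)"
proof -
  have "poly p x + poly q x > 4" if "x \<ge> 1" for x
    using assms that add_strict_mono[of 4 "poly p x" 4 "poly q x"]
    by (simp add: admissible_poly_def)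
  then show ?thesis
    using assms by (auto simp: admissible_poly_def mono_on_def intro!: add_mono)
qed

lemma admissible_poly_mult:
  assumes "admissible_poly p" "admissible_poly q"
  shows "admissible_poly (p * q)"
proof -
  have gt: "poly p x > 4" "poly q x > 4" if "x \<ge> 1" for x
    using assms that by (auto simp: admissible_poly_def)
  have mono: "poly p x \<le> poly p y" "poly q x \<le> poly q y" if "1 \<le> x" "x \<le> y" for x y
    using assms that by (auto simp: admissible_poly_def mono_on_def)
  have "poly p x * poly q x > 4" if "x \<ge> 1" for x
    using mult_strict_mono[OF gt(1)[OF that], of 1 "poly q x"] gt[OF that] by simp
  moreover have "poly p x * poly q x \<le> poly p y * poly q y" if "1 \<le> x" "x \<le> y" for x y
    using mono[OF that] gt[of x] gt[of y] that by (intro mult_mono) auto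
  ultimately show ?thesis by (auto simp: admissible_poly_def mono_on_def)
qed

section \<open>From mixed to forward stability\<close>

theorem theorem5p11:
  fixes F :: scalable_fun and A :: "nat \<Rightarrow> arithmetic" and P :: machine
  assumes "is_scalable F"
    and "amenable F"
    and "\<forall>t>2. fp_arithmetic t (A t)"
    and "bss_machine P"
    and "mixed_stable A P F"
  shows "forward_stable A P F"
proof -
  obtain \<alpha> where \<alpha>: "admissible_poly \<alpha>"
    and amen: "\<And>k x. k \<in> sf_index F \<Longrightarrow> x \<in> sf_dom F k \<Longrightarrow> amen_ball F \<alpha> k x \<subseteq> sf_dom F k"
      "\<And>k x. k \<in> sf_index F \<Longrightarrow> x \<in> sf_dom F k \<Longrightarrow> \<forall>y\<in>amen_ball F \<alpha> k x.
        sf_cond1 F k y \<le> ennreal (poly \<alpha> (real (sf_size F k))) * sf_cond1 F k x"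
    using assms(2) unfolding amenable_def by blast
  obtain a b c where abc: "admissible_poly a" "admissible_poly b" "admissible_poly c"
    and mixed: "\<And>k x t. k \<in> sf_index F \<Longrightarrow> x \<in> sf_dom F k \<Longrightarrow> t > 2 \<Longrightarrow>
        roundoff t \<le> 1 / poly a (real (sf_size F k)) \<Longrightarrow>
        \<exists>z. produces t (A t) P x z \<and>
          (\<exists>y\<in>sf_dom F k.
            rel_dist z (sf_map F k y) \<le> ennreal (poly b (real (sf_size F k)) * roundoff t) \<and>
            rel_dist x y \<le> ennreal (poly c (real (sf_size F k)) * roundoff t))"
    using assms(5) unfolding mixed_stable_def by blast
  \<comment> \<open>The term \<open>a\<close> secures the roundoff threshold of mixed stability and
    \<open>b\<close> pays for the output error. The product \<open>\<alpha> * c\<close> both puts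
    \<open>y\<close> into the ball of \<open>x\<close> and bounds the propagated input
    error.\<close>
  define p where "p = \<alpha> * c + b + a"
  have p: "admissible_poly p"
    unfolding p_def using \<alpha> abc by (intro admissible_poly_add admissible_poly_mult)
  have "\<exists>z. produces t (A t) P x z \<and> rel_dist z (sf_map F k x)
      \<le> ennreal (poly p (real (sf_size F k))) * sf_cond1 F k x * ennreal (roundoff t)"
    if k: "k \<in> sf_index F" and x: "x \<in> sf_dom F k" and t: "t > 2"
      and u: "ennreal (roundoff t) \<le> 1 / (sf_cond1 F k x * ennreal (poly p (real (sf_size F k))))"
    for k x t
  proof -
    define M where "M = real (sf_size F k)"
    define u where "u = roundoff t"
    have M: "M \<ge> 1" and dom: "sf_dom F k \<subseteq> space_R (sf_in F k)"
      using assms(1) k by (auto simp: is_scalable_def M_def sf_size_def)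
    have pos: "poly \<alpha> M > 4" "poly a M > 4" "poly b M > 4" "poly c M > 4"
      using \<alpha> abc M by (auto simp: admissible_poly_def)
    have pM: "poly p M = poly \<alpha> M * poly c M + poly b M + poly a M" by (simp add: p_def)
    have ac: "poly \<alpha> M * poly c M > 0" using pos by simp
    then have ppos: "poly p M > 0" using pos pM by linarith
    have upos: "u > 0" by (simp add: u_def roundoff_def)
    \<comment> \<open>With an infinite condition number the bound on the roundoff would be 0,
      contradicting \<open>u > 0\<close>.\<close>
    have "sf_cond1 F k x \<noteq> top"
    proof
      assume "sf_cond1 F k x = top"
      then show False
        using u ppos upos by (simp add: M_def u_def ennreal_top_mult)
    qed
    then obtain K where K: "sf_cond1 F k x = ennreal K" "K \<ge> 0" by (cases "sf_cond1 F k x") auto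
    have "ennreal 1 \<le> sf_cond1 F k x" by (simp add: sf_cond1_def cond_num1_def)
    then have K1: "K \<ge> 1" unfolding K(1) using K(2) by (subst (asm) ennreal_le_iff) auto
    have "ennreal u \<le> ennreal (1 / (K * poly p M))"
      using u K K1 ppos
      by (simp add: M_def[symmetric] u_def[symmetric] ennreal_mult[symmetric]
          divide_ennreal[symmetric])
    then have "u \<le> 1 / (K * poly p M)"
      using K1 ppos by (subst (asm) ennreal_le_iff) auto
    then have up: "u * K * poly p M \<le> 1" using K1 ppos by (simp add: field_simps)
    \<comment> \<open>Only the summand \<open>a\<close> of \<open>p\<close> is kept, using
      \<open>K \<ge> 1\<close>.\<close>
    have "u * (1 * poly a M) \<le> u * (K * poly p M)"
      using K1 pos upos ac pM by (intro mult_left_mono mult_mono) auto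
    then have "u * poly a M \<le> 1" using up by (simp add: mult.assoc)
    then have "roundoff t \<le> 1 / poly a M"
      using pos by (simp add: u_def field_simps)
    from mixed[OF k x t this[unfolded M_def]]
    obtain z y where z: "produces t (A t) P x z" and y: "y \<in> sf_dom F k"
      and zy: "rel_dist z (sf_map F k y) \<le> ennreal (poly b M * u)"
      and xy: "rel_dist x y \<le> ennreal (poly c M * u)"
      unfolding M_def u_def by blast
    \<comment> \<open>Now only \<open>\<alpha> * c\<close> is kept: \<open>c u\<close> is at most
      the radius \<open>1 / (\<alpha> K)\<close> of the ball.\<close>
    have "u * K * (poly \<alpha> M * poly c M) \<le> u * K * poly p M"
      using K1 pos upos pM by (intro mult_left_mono) auto
    then have "poly c M * u * (poly \<alpha> M * K) \<le> 1"
      using up by (simp add: mult_ac)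
    then have "poly c M * u \<le> 1 / (poly \<alpha> M * K)"
      using K1 pos by (simp add: pos_le_divide_eq)
    then have "ennreal (poly c M * u) \<le> 1 / (ennreal (poly \<alpha> M) * sf_cond1 F k x)"
      using K K1 pos
      by (simp add: ennreal_mult[symmetric] divide_ennreal ennreal_leI flip: ennreal_1)
    then have ball: "y \<in> amen_ball F \<alpha> k x"
      using y dom order_trans[OF xy] by (auto simp: amen_ball_def M_def)
    have fin: "rel_dist x y < \<infinity>" using xy by (simp add: order_le_less_trans)
    have "rel_dist (sf_map F k y) (sf_map F k x) = rel_dist (sf_map F k x) (sf_map F k y)"
      by (rule rel_dist_commute)
    also have "\<dots> \<le> ennreal (poly \<alpha> M * K) * rel_dist x y"
      using amenable_lipschitz[OF amen[OF k x] _ K _ ball fin] x dom pos by (auto simp: M_def)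
    also have "\<dots> \<le> ennreal (poly \<alpha> M * K) * ennreal (poly c M * u)"
      using xy by (rule mult_left_mono) simp
    finally have yx: "rel_dist (sf_map F k y) (sf_map F k x)
        \<le> ennreal (poly \<alpha> M * K) * ennreal (poly c M * u)" .
    have "rel_dist z (sf_map F k x)
        \<le> rel_dist z (sf_map F k y) + rel_dist (sf_map F k y) (sf_map F k x)"
      by (rule rel_dist_triangle)
    also have "\<dots> \<le> ennreal (poly b M * u) + ennreal (poly \<alpha> M * K) * ennreal (poly c M * u)"
      using zy yx by (rule add_mono)
    also have "\<dots> = ennreal (poly b M * u + poly \<alpha> M * K * (poly c M * u))"
      using pos upos K1 by (simp add: ennreal_plus ennreal_mult)
    also have "\<dots> \<le> ennreal (poly p M * K * u)"
    \<comment> \<open>The output error \<open>b u\<close> carries no condition number;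
      \<open>K \<ge> 1\<close> inserts it, and the term from \<open>a\<close> is nonnegative
      slack.\<close>
    proof (rule ennreal_leI)
      have "1 * poly b M * u \<le> K * poly b M * u"
        using K1 pos upos by (intro mult_right_mono) auto
      moreover have "0 \<le> K * poly a M * u" using K1 pos upos by simp
      ultimately show "poly b M * u + poly \<alpha> M * K * (poly c M * u) \<le> poly p M * K * u"
        by (simp add: pM algebra_simps)
    qed
    also have "\<dots> = ennreal (poly p M) * sf_cond1 F k x * ennreal u"
      using ppos K upos by (simp add: ennreal_mult)
    finally show ?thesis using z by (auto simp: M_def u_def)
  qed
  with p show ?thesis unfolding forward_stable_def by blast
qed

end
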